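(* Let $A\ge 0$ in $\mathbb{M}_n$, let $p,q\ge 0$ be real numbers, and let $\Phi:\mathbb{M}_n\to\mathbb{M}_d$ be a unital positive linear map. Then, for every $j=1,\dots,d$, $$\lambda_j[\Phi(A^p)]\,\lambda_j[\Phi(A^q)]\le\lambda_j[\Phi(A^{p+q})].$$
   Context: $\mathbb{M}_n$ is the algebra of $n\times n$ complex matrices, and $A\ge 0$ means $A$ is positive semidefinite. A linear map $\Phi$ is positive if it maps positive semidefinite matrices to positive semidefinite matrices, and unital if $\Phi(I)=I$. Powers are defined by functional calculus, with $A^0=I$. For a Hermitian matrix $X$, $\lambda_1[X]\ge\lambda_2[X]\ge\cdots$ are its eigenvalues in decreasing order, counted with multiplicity. *)

theory Defs
  imports
    "HOL-Computational_Algebra.Computational_Algebra"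
    "Jordan_Normal_Form.Schur_Decomposition"
begin

definition hermitian_mat :: "complex mat \<Rightarrow> bool" where
  "hermitian_mat X \<longleftrightarrow> mat_adjoint X = X"

definition psd_mat :: "complex mat \<Rightarrow> bool" where
  "psd_mat X \<longleftrightarrow> hermitian_mat X \<and>
     (\<forall>v \<in> carrier_vec (dim_row X). 0 \<le> Re ((X *\<^sub>v v) \<bullet>c v))"

definition unitary_mat :: "complex mat \<Rightarrow> bool" where
  "unitary_mat U \<longleftrightarrow> square_mat U \<and> mat_adjoint U * U = 1\<^sub>m (dim_row U)"

(* U diag(a_0, ..., a_{n-1}) U^* *)
definition unitary_diag :: "nat \<Rightarrow> complex mat \<Rightarrow> (nat \<Rightarrow> real) \<Rightarrow> complex mat" where
  "unitary_diag n U a = U * mat_diag n (\<lambda>i. complex_of_real (a i)) * mat_adjoint U"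

(* Functional calculus f(A) of a Hermitian matrix A. The result does not depend on the
   chosen diagonalization, see mat_fun_eq below. *)
definition mat_fun :: "(real \<Rightarrow> real) \<Rightarrow> complex mat \<Rightarrow> complex mat" where
  "mat_fun f A = (THE B. \<exists>U a. U \<in> carrier_mat (dim_row A) (dim_row A) \<and> unitary_mat U \<and>
     A = unitary_diag (dim_row A) U a \<and> B = unitary_diag (dim_row A) U (f \<circ> a))"

(* The case p = 0 is separate because 0 powr 0 = 0, whereas A^0 = I is wanted
   for singular A as well. *)
definition mat_powr :: "complex mat \<Rightarrow> real \<Rightarrow> complex mat" where
  "mat_powr A p = mat_fun (\<lambda>x. if p = 0 then 1 else x powr p) A"

(* The j-th largest eigenvalue, counted from j = 1, of a Hermitian matrix. Its eigenvalues
   are real, so taking real parts loses nothing. *)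
definition eigval_desc :: "complex mat \<Rightarrow> nat \<Rightarrow> real" where
  "eigval_desc X j =
     rev (sorted_list_of_multiset (image_mset Re (proots (char_poly X)))) ! (j - 1)"

definition linear_mat_map :: "nat \<Rightarrow> nat \<Rightarrow> (complex mat \<Rightarrow> complex mat) \<Rightarrow> bool" where
  "linear_mat_map n d \<Phi> \<longleftrightarrow>
     (\<forall>X \<in> carrier_mat n n. \<Phi> X \<in> carrier_mat d d) \<and>
     (\<forall>X \<in> carrier_mat n n. \<forall>Y \<in> carrier_mat n n. \<Phi> (X + Y) = \<Phi> X + \<Phi> Y) \<and>
     (\<forall>c. \<forall>X \<in> carrier_mat n n. \<Phi> (c \<cdot>\<^sub>m X) = c \<cdot>\<^sub>m \<Phi> X)"

definition positive_mat_map :: "nat \<Rightarrow> (complex mat \<Rightarrow> complex mat) \<Rightarrow> bool" where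
  "positive_mat_map n \<Phi> \<longleftrightarrow> (\<forall>X \<in> carrier_mat n n. psd_mat X \<longrightarrow> psd_mat (\<Phi> X))"

definition unital_mat_map :: "nat \<Rightarrow> nat \<Rightarrow> (complex mat \<Rightarrow> complex mat) \<Rightarrow> bool" where
  "unital_mat_map n d \<Phi> \<longleftrightarrow> \<Phi> (1\<^sub>m n) = 1\<^sub>m d"

lemma mat_adjoint_carrier: "X \<in> carrier_mat m n \<Longrightarrow> mat_adjoint X \<in> carrier_mat n m"
  by (auto simp: mat_adjoint_def mat_of_rows_def)

lemma unitary_diag_carrier:
  "U \<in> carrier_mat n n \<Longrightarrow> unitary_diag n U a \<in> carrier_mat n n"
  unfolding unitary_diag_def by (intro mult_carrier_mat mat_adjoint_carrier) auto

lemma unitary_matD: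
  assumes "U \<in> carrier_mat n n" "unitary_mat U"
  shows "mat_adjoint U * U = 1\<^sub>m n" "U * mat_adjoint U = 1\<^sub>m n"
proof -
  show *: "mat_adjoint U * U = 1\<^sub>m n"
    using assms by (simp add: unitary_mat_def)
  show "U * mat_adjoint U = 1\<^sub>m n"
    by (rule mat_mult_left_right_inverse[OF mat_adjoint_carrier[OF assms(1)] assms(1) *])
qed

lemma intertwine_iff:
  fixes U V W X D E :: "complex mat"
  assumes c: "U \<in> carrier_mat n n" "V \<in> carrier_mat n n" "W \<in> carrier_mat n n"
      "X \<in> carrier_mat n n" "D \<in> carrier_mat n n" "E \<in> carrier_mat n n"
    and u: "V * U = 1\<^sub>m n" "U * V = 1\<^sub>m n" and w: "X * W = 1\<^sub>m n" "W * X = 1\<^sub>m n"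
  shows "U * D * V = W * E * X \<longleftrightarrow> X * U * D = E * (X * U)"
proof
  note [simp] = c mult_carrier_mat[of _ n n _ n] and as = assoc_mult_mat[of _ n n _ n _ n]
  assume eq: "U * D * V = W * E * X"
  have "X * U * D = X * U * D * (V * U)" using u by (simp add: right_mult_one_mat[of _ n n])
  also have "\<dots> = X * (U * D * V) * U" by (simp add: as)
  also have "\<dots> = (X * W) * (E * (X * U))" unfolding eq by (simp add: as)
  finally show "X * U * D = E * (X * U)" using w by (simp add: left_mult_one_mat[of _ n n])
next
  note [simp] = c mult_carrier_mat[of _ n n _ n] and as = assoc_mult_mat[of _ n n _ n _ n]
  assume eq: "X * U * D = E * (X * U)"
  have "U * D * V = (W * X) * (U * D * V)" using w by (simp add: left_mult_one_mat[of _ n n])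
  also have "\<dots> = W * (X * U * D) * V" by (simp add: as)
  also have "\<dots> = W * E * X * (U * V)" unfolding eq by (simp add: as)
  finally show "U * D * V = W * E * X" using u by (simp add: right_mult_one_mat[of _ n n])
qed

lemma unitary_diag_eq_iff:
  assumes U: "U \<in> carrier_mat n n" "unitary_mat U" and W: "W \<in> carrier_mat n n" "unitary_mat W"
  shows "unitary_diag n U a = unitary_diag n W b \<longleftrightarrow>
    (mat_adjoint W * U) * mat_diag n (\<lambda>i. complex_of_real (a i)) =
    mat_diag n (\<lambda>i. complex_of_real (b i)) * (mat_adjoint W * U)"
  unfolding unitary_diag_def
  by (rule intertwine_iff[OF U(1) mat_adjoint_carrier[OF U(1)] W(1) mat_adjoint_carrier[OF W(1)]
        mat_diag_dim mat_diag_dim unitary_matD[OF U] unitary_matD[OF W]])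

lemma unitary_diag_comp_cong:
  assumes U: "U \<in> carrier_mat n n" "unitary_mat U" and W: "W \<in> carrier_mat n n" "unitary_mat W"
    and eq: "unitary_diag n U a = unitary_diag n W b"
  shows "unitary_diag n U (f \<circ> a) = unitary_diag n W (f \<circ> b)"
proof -
  define Z where "Z = mat_adjoint W * U"
  have Z: "Z \<in> carrier_mat n n" using mat_adjoint_carrier[OF W(1)] U(1) by (simp add: Z_def)
  have "Z * mat_diag n (\<lambda>i. complex_of_real (a i)) = mat_diag n (\<lambda>i. complex_of_real (b i)) * Z"
    using eq unfolding unitary_diag_eq_iff[OF U W] Z_def .
  then have ent: "mat n n (\<lambda>(i,j). Z $$ (i,j) * complex_of_real (a j)) =
      mat n n (\<lambda>(i,j). complex_of_real (b i) * Z $$ (i,j))"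
    by (simp add: mat_diag_mult_left[OF Z] mat_diag_mult_right[OF Z])
  have *: "Z $$ (i,j) = 0 \<or> a j = b i" if "i < n" "j < n" for i j
    using arg_cong[OF ent, of "\<lambda>M. M $$ (i,j)"] that by auto
  have "Z * mat_diag n (\<lambda>i. complex_of_real ((f \<circ> a) i)) =
      mat_diag n (\<lambda>i. complex_of_real ((f \<circ> b) i)) * Z"
    unfolding mat_diag_mult_left[OF Z] mat_diag_mult_right[OF Z]
    by (rule eq_matI) (use * in force)+
  then show ?thesis unfolding unitary_diag_eq_iff[OF U W] Z_def .
qed

lemma mat_fun_eq:
  assumes U: "U \<in> carrier_mat n n" "unitary_mat U" and A: "A = unitary_diag n U a"
  shows "mat_fun f A = unitary_diag n U (f \<circ> a)"
proof -
  have n: "dim_row A = n" using unitary_diag_carrier[OF U(1)] A by auto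
  show ?thesis
    unfolding mat_fun_def n
  proof (rule the_equality)
    show "\<exists>U' a'. U' \<in> carrier_mat n n \<and> unitary_mat U' \<and> A = unitary_diag n U' a' \<and>
        unitary_diag n U (f \<circ> a) = unitary_diag n U' (f \<circ> a')"
      using U A by blast
    show "B = unitary_diag n U (f \<circ> a)"
      if ex: "\<exists>U' a'. U' \<in> carrier_mat n n \<and> unitary_mat U' \<and> A = unitary_diag n U' a' \<and>
        B = unitary_diag n U' (f \<circ> a')" for B
    proof -
      from ex obtain U' a' where U': "U' \<in> carrier_mat n n" "unitary_mat U'"
        and eq: "A = unitary_diag n U' a'" and B: "B = unitary_diag n U' (f \<circ> a')"
        by blast
      show ?thesis
        unfolding B by (rule unitary_diag_comp_cong[OF U' U]) (rule trans[OF eq[symmetric] A])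
    qed
  qed
qed

end

(* For every e > 0, weighted AM-GM gives the scalar inequality
     x^p <= p/(p+q) * e^(-q) * x^(p+q) + q/(p+q) * e^p   (x >= 0),
   which is affine in x^(p+q), so a unital positive map carries it over to matrices:
     Phi(A^p) <= p/(p+q) * e^(-q) * Phi(A^(p+q)) + q/(p+q) * e^p * I.
   Eigenvalues are monotone in the Loewner order. Hence, if e^(p+q) is an upper bound of the
   j-th eigenvalue of Phi(A^(p+q)), then the j-th eigenvalue of Phi(A^p) is at most e^p.
   By symmetry that of Phi(A^q) is at most e^q, so the product is at most e^(p+q). *)

theory Submission
  imports Defs
begin

section \<open>Adjoints and unitary matrices\<close>

lemma index_mat_adjoint [simp]:
  assumes "i < dim_col A" "j < dim_row A"
  shows "mat_adjoint A $$ (i, j) = conjugate (A $$ (j, i))"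
  using assms by (simp add: mat_adjoint_def mat_of_rows_index)

lemma dim_mat_adjoint [simp]:
  "dim_row (mat_adjoint A) = dim_col A" "dim_col (mat_adjoint A) = dim_row A"
  by (simp_all add: mat_adjoint_def)

lemma mat_adjoint_adjoint [simp]: "mat_adjoint (mat_adjoint A) = A"
  by (rule eq_matI) auto

lemma mat_adjoint_mult:
  fixes A B :: "complex mat"
  assumes "A \<in> carrier_mat n m" "B \<in> carrier_mat m k"
  shows "mat_adjoint (A * B) = mat_adjoint B * mat_adjoint A"
  using assms by (intro eq_matI) (auto simp: scalar_prod_def mult.commute)

lemma mult_mat_vec_adjoint_left:
  fixes X :: "complex mat"
  assumes "X \<in> carrier_mat n m" "v \<in> carrier_vec m" "w \<in> carrier_vec n"
  shows "(X *\<^sub>v v) \<bullet>c w = v \<bullet>c (mat_adjoint X *\<^sub>v w)"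
proof -
  have "(X *\<^sub>v v) \<bullet>c w = (\<Sum>i<n. \<Sum>j<m. X $$ (i,j) * v $ j * cnj (w $ i))"
    using assms by (auto simp: scalar_prod_def sum_distrib_right lessThan_atLeast0 intro!: sum.cong)
  also have "\<dots> = (\<Sum>j<m. \<Sum>i<n. X $$ (i,j) * v $ j * cnj (w $ i))"
    by (rule sum.swap)
  also have "\<dots> = v \<bullet>c (mat_adjoint X *\<^sub>v w)"
    using assms by (auto simp: scalar_prod_def sum_distrib_left lessThan_atLeast0 mult_ac intro!: sum.cong)
  finally show ?thesis .
qed

lemma unitary_matI:
  assumes "U \<in> carrier_mat n n" "mat_adjoint U * U = 1\<^sub>m n"
  shows "unitary_mat U"
  using assms by (simp add: unitary_mat_def)

lemma unitary_mat_mult: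
  assumes U: "U \<in> carrier_mat n n" "unitary_mat U" and V: "V \<in> carrier_mat n n" "unitary_mat V"
  shows "unitary_mat (U * V)"
proof (rule unitary_matI)
  note [simp] = U(1) V(1) mat_adjoint_carrier mult_carrier_mat[of _ n n _ n]
  have "mat_adjoint (U * V) * (U * V) = mat_adjoint V * (mat_adjoint U * U) * V"
    by (simp add: mat_adjoint_mult[of _ n n _ n] assoc_mult_mat[of _ n n _ n _ n])
  then show "mat_adjoint (U * V) * (U * V) = 1\<^sub>m n"
    by (simp add: unitary_matD[OF U] unitary_matD[OF V] right_mult_one_mat[of _ n n])
  show "U * V \<in> carrier_mat n n" by simp
qed

text \<open>Gram-Schmidt yields pairwise orthogonal vectors without normalizing them. Dividing each
  by its norm gives orthonormal columns; the factors \<open>c i\<close> stay in the conclusion so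
  that the direction of each column remains known.\<close>

lemma unitary_mat_of_orthogonal_list:
  fixes ws :: "complex vec list"
  assumes ws: "set ws \<subseteq> carrier_vec n" "corthogonal ws" "length ws = n"
  obtains W c where "W \<in> carrier_mat n n" "unitary_mat W"
    "\<And>i. i < n \<Longrightarrow> col W i = c i \<cdot>\<^sub>v ws ! i"
proof -
  define c where "c i = complex_of_real (1 / sqrt (Re (ws ! i \<bullet>c ws ! i)))" for i
  define W where "W = mat_of_cols n (map (\<lambda>i. c i \<cdot>\<^sub>v ws ! i) [0..<n])"
  have W: "W \<in> carrier_mat n n" by (simp add: W_def carrier_matI)
  have wsi: "ws ! i \<in> carrier_vec n" if "i < n" for i using ws that by auto
  have colW: "col W i = c i \<cdot>\<^sub>v ws ! i" if "i < n" for i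
    using that wsi by (simp add: W_def col_mat_of_cols)
  have "mat_adjoint W * W = 1\<^sub>m n"
  proof (rule eq_matI)
    fix i j assume "i < dim_row (1\<^sub>m n :: complex mat)" "j < dim_col (1\<^sub>m n :: complex mat)"
    then have ij: "i < n" "j < n" by auto
    have "(mat_adjoint W * W) $$ (i, j) = (\<Sum>k<n. cnj (W $$ (k,i)) * W $$ (k,j))"
      using W ij by (simp add: scalar_prod_def lessThan_atLeast0)
    also have "\<dots> = col W j \<bullet>c col W i"
      using W ij by (auto simp: scalar_prod_def lessThan_atLeast0 mult.commute intro!: sum.cong)
    also have "\<dots> = c j * cnj (c i) * (ws ! j \<bullet>c ws ! i)"
      using wsi[OF ij(1)] wsi[OF ij(2)] ij
      by (simp add: colW conjugate_smult_vec smult_scalar_prod_distrib[of _ n]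
          scalar_prod_smult_distrib[of _ n])
    also have "\<dots> = (if i = j then 1 else 0)"
    proof (cases "i = j")
      case False
      then have "ws ! j \<bullet>c ws ! i = 0" using ws ij by (auto dest: corthogonalD)
      with False show ?thesis by simp
    next
      case True
      \<comment> \<open>\<open>r\<close> is the squared norm, nonzero by \<open>corthogonal\<close>.
        Hence the real part and the square root in \<open>c i\<close> are harmless, and two factors
        \<open>1 / sqrt r\<close> cancel it.\<close>
      define r where "r = (\<Sum>k<n. (cmod (ws ! i $ k))\<^sup>2)"
      have r: "ws ! i \<bullet>c ws ! i = complex_of_real r"
        using wsi[OF ij(1)]
        by (simp add: scalar_prod_def r_def lessThan_atLeast0 complex_norm_square flip: of_real_power)
      have "ws ! i \<bullet>c ws ! i \<noteq> 0" using ws ij by (auto dest: corthogonalD)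
      then have "r \<noteq> 0" using r by auto
      moreover have "r \<ge> 0" unfolding r_def by (intro sum_nonneg) auto
      ultimately have "1 / sqrt r * (1 / sqrt r) * r = 1" by simp
      then show ?thesis using True r
        unfolding c_def by (metis Re_complex_of_real complex_cnj_complex_of_real of_real_1 of_real_mult)
    qed
    finally show "(mat_adjoint W * W) $$ (i, j) = 1\<^sub>m n $$ (i, j)" using ij by simp
  qed (use W in auto)
  from unitary_matI[OF W this] W colW show ?thesis by (blast intro: that)
qed

text \<open>Complete \<open>v\<close> to a basis with \<open>v\<close> in front; Gram-Schmidt leaves
  the first vector unchanged. With an eigenvector for \<open>v\<close> this provides the change of
  basis for deflation.\<close>

lemma unitary_mat_with_first_column:
  fixes v :: "complex vec"
  assumes v: "v \<in> carrier_vec n" and v0: "v \<noteq> 0\<^sub>v n"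
  obtains W c where "W \<in> carrier_mat n n" "unitary_mat W" "col W 0 = c \<cdot>\<^sub>v v"
proof -
  interpret cof_vec_space n "TYPE(complex)" .
  define b where "b = basis_completion v"
  from basis_completion[OF v v0, folded b_def]
  have dist: "distinct b" and indep: "\<not> lin_dep (set b)" and b: "set b \<subseteq> carrier_vec n"
    and hd: "hd b = v" and len: "length b = n" by auto
  have n: "n \<noteq> 0" using v v0 by (auto intro: eq_vecI)
  then obtain vs where bv: "b = v # vs" using hd len by (cases b) auto
  define ws where "ws = gram_schmidt n b"
  have ws: "set ws \<subseteq> carrier_vec n" "corthogonal ws" "length ws = n"
    using gram_schmidt_result[OF b dist indep ws_def] len by auto
  have "hd ws = v" using gram_schmidt_hd[OF v, of vs] by (simp add: ws_def bv)
  then have "ws ! 0 = v" using ws(3) n by (cases ws) auto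
  moreover obtain W c where W: "W \<in> carrier_mat n n" "unitary_mat W"
    and "\<And>i. i < n \<Longrightarrow> col W i = c i \<cdot>\<^sub>v ws ! i"
    using unitary_mat_of_orthogonal_list[OF ws] by blast
  ultimately show ?thesis using n W that[of W "c 0"] by simp
qed

section \<open>Spectral theorem with a prescribed order of the eigenvalues\<close>

lemma mat_adjoint_four_block_diag:
  fixes A D :: "complex mat"
  assumes "A \<in> carrier_mat k k" "D \<in> carrier_mat m m"
  shows "mat_adjoint (four_block_mat A (0\<^sub>m k m) (0\<^sub>m m k) D) =
    four_block_mat (mat_adjoint A) (0\<^sub>m k m) (0\<^sub>m m k) (mat_adjoint D)"
  using assms by (intro eq_matI) auto

lemma mult_four_block_diag:
  fixes A B C D :: "complex mat"
  assumes "A \<in> carrier_mat k k" "B \<in> carrier_mat m m" "C \<in> carrier_mat k k" "D \<in> carrier_mat m m"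
  shows "four_block_mat A (0\<^sub>m k m) (0\<^sub>m m k) B * four_block_mat C (0\<^sub>m k m) (0\<^sub>m m k) D =
    four_block_mat (A * C) (0\<^sub>m k m) (0\<^sub>m m k) (B * D)"
proof -
  have "four_block_mat A (0\<^sub>m k m) (0\<^sub>m m k) B * four_block_mat C (0\<^sub>m k m) (0\<^sub>m m k) D =
    four_block_mat (A * C + 0\<^sub>m k m * 0\<^sub>m m k) (A * 0\<^sub>m k m + 0\<^sub>m k m * D)
      (0\<^sub>m m k * C + B * 0\<^sub>m m k) (0\<^sub>m m k * 0\<^sub>m k m + B * D)"
    using assms by (intro mult_four_block_mat) auto
  moreover have "A * C \<in> carrier_mat k k" "B * D \<in> carrier_mat m m" using assms by auto
  ultimately show ?thesis using assms by simp
qed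

lemma hermitian_mat_unitary_conj:
  assumes X: "X \<in> carrier_mat n n" "hermitian_mat X" and W: "W \<in> carrier_mat n n"
  shows "hermitian_mat (mat_adjoint W * X * W)"
proof -
  note [simp] = X(1) W mat_adjoint_carrier mult_carrier_mat[of _ n n _ n]
  have "mat_adjoint (mat_adjoint W * X * W) = mat_adjoint W * (mat_adjoint X * W)"
    by (simp add: mat_adjoint_mult[of _ n n _ n])
  also have "\<dots> = mat_adjoint W * X * W"
    using X(2) by (simp add: hermitian_mat_def assoc_mult_mat[of _ n n _ n _ n])
  finally show ?thesis by (simp add: hermitian_mat_def)
qed

text \<open>Deflation, by induction on the list of roots: an eigenvector for the first root splits
  off a 1 x 1 block, and the rest is Hermitian with the remaining roots. Since \<open>es\<close> may
  list the roots in any order, a decreasing one can be chosen later. The roots are still complex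
  here.\<close>

lemma hermitian_diagonalization:
  assumes "X \<in> carrier_mat n n" "hermitian_mat X" "char_poly X = (\<Prod>e\<leftarrow>es. [:- e, 1:])"
  shows "\<exists>U \<in> carrier_mat n n. unitary_mat U \<and> X = U * mat_diag n (\<lambda>i. es ! i) * mat_adjoint U"
  using assms
proof (induction es arbitrary: n X)
  case Nil
  then have "n = 0" using degree_monic_char_poly[of X n] by auto
  then show ?case using Nil
    by (intro bexI[of _ "1\<^sub>m 0"]) (auto simp: unitary_mat_def intro!: eq_matI)
next
  case (Cons e es)
  note X = Cons.prems(1)
  have "monic (\<Prod>e\<leftarrow>es. [:- e, 1:])" by (rule monic_prod_list) auto
  then have "degree (char_poly X) = Suc (degree (\<Prod>e\<leftarrow>es. [:- e, 1:]))"
    unfolding Cons.prems(3) list.map prod_list.Cons by (subst degree_mult_eq) auto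
  with degree_monic_char_poly[OF X] obtain m where n: "n = Suc m" by (cases n) auto
  have "eigenvalue X e"
    unfolding eigenvalue_root_char_poly[OF X] Cons.prems(3) by simp
  then obtain v where v: "v \<in> carrier_vec n" "v \<noteq> 0\<^sub>v n" and ev: "X *\<^sub>v v = e \<cdot>\<^sub>v v"
    using X by (auto simp: eigenvalue_def eigenvector_def)
  obtain W c where W: "W \<in> carrier_mat n n" "unitary_mat W" and W0: "col W 0 = c \<cdot>\<^sub>v v"
    using unitary_mat_with_first_column[OF v] by blast
  define W' where "W' = mat_adjoint W"
  define M where "M = W' * X * W"
  have W': "W' \<in> carrier_mat n n" using mat_adjoint_carrier[OF W(1)] by (simp add: W'_def)
  have W'W: "W' * W = 1\<^sub>m n" and WW': "W * W' = 1\<^sub>m n"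
    using unitary_matD[OF W] by (simp_all add: W'_def)
  note as = assoc_mult_mat[of _ n n _ n _ n] and cm = mult_carrier_mat[of _ n n _ n]
  have M: "M \<in> carrier_mat n n" using X W W' by (simp add: M_def cm)
  \<comment> \<open>The first column of \<open>W\<close> is an eigenvector of \<open>X\<close>, so
    in the basis given by \<open>W\<close> it becomes \<open>e\<close> times the first unit
    vector.\<close>
  have "col M 0 = W' *\<^sub>v (X *\<^sub>v col W 0)"
  proof -
    have "col M 0 = col (W' * (X * W)) 0" using X W W' by (simp add: M_def as)
    also have "\<dots> = W' *\<^sub>v (X *\<^sub>v col W 0)"
      using n by (simp only: col_mult2[OF W' cm[OF X W(1)]] col_mult2[OF X W(1)] zero_less_Suc)
    finally show ?thesis .
  qed
  also have "X *\<^sub>v col W 0 = e \<cdot>\<^sub>v col W 0"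
    using X v ev by (simp add: W0 mult_mat_vec[of _ n n] smult_smult_assoc mult.commute)
  also have "W' *\<^sub>v (e \<cdot>\<^sub>v col W 0) = e \<cdot>\<^sub>v col (W' * W) 0"
    using W(1) n by (simp only: mult_mat_vec[OF W' col_carrier_vec[OF _ W(1)]] col_mult2[OF W' W(1)]
        zero_less_Suc)
  finally have col0: "col M 0 = e \<cdot>\<^sub>v col (1\<^sub>m n) 0" unfolding W'W .
  have M_herm: "hermitian_mat M"
    unfolding M_def W'_def by (rule hermitian_mat_unitary_conj[OF X Cons.prems(2) W(1)])
  have M_sym: "cnj (M $$ (j, i)) = M $$ (i, j)" if "i < n" "j < n" for i j
    using arg_cong[OF M_herm[unfolded hermitian_mat_def], of "\<lambda>Y. Y $$ (i, j)"] M that by simp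
  have Mi0: "M $$ (i, 0) = (if i = 0 then e else 0)" if "i < n" for i
    using arg_cong[OF col0, of "\<lambda>w. vec_index w i"] M that n by (simp split: if_splits)
  \<comment> \<open>Hermitian symmetry carries the zeros of the first column over to the first row,
    so \<open>M\<close> is block diagonal.\<close>
  have M0j: "M $$ (0, j) = 0" if "j < n" "j \<noteq> 0" for j
    using M_sym[of 0 j] Mi0[of j] that n by simp
  define E where "E = mat 1 1 (\<lambda>_. e)"
  define M3 where "M3 = mat m m (\<lambda>(i,j). M $$ (Suc i, Suc j))"
  have E: "E \<in> carrier_mat 1 1" and M3: "M3 \<in> carrier_mat m m" by (simp_all add: E_def M3_def)
  have Mblock: "M = four_block_mat E (0\<^sub>m 1 m) (0\<^sub>m m 1) M3"
  proof (rule eq_matI)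
    fix i j
    assume "i < dim_row (four_block_mat E (0\<^sub>m 1 m) (0\<^sub>m m 1) M3)"
      "j < dim_col (four_block_mat E (0\<^sub>m 1 m) (0\<^sub>m m 1) M3)"
    then have "i < n" "j < n" by (simp_all add: E_def M3_def n)
    then show "M $$ (i, j) = four_block_mat E (0\<^sub>m 1 m) (0\<^sub>m m 1) M3 $$ (i, j)"
      using Mi0[of i] M0j[of j] by (auto simp: E_def M3_def n)
  qed (use M in \<open>auto simp: E_def M3_def n\<close>)
  have M3_herm: "hermitian_mat M3"
    unfolding hermitian_mat_def
    by (rule eq_matI) (use M_sym in \<open>auto simp: M3_def n\<close>)
  \<comment> \<open>Similarity preserves the characteristic polynomial, which factors over the
    blocks; cancelling the linear factor of \<open>e\<close> leaves exactly the factorization that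
    the induction requires of \<open>M3\<close>.\<close>
  have "similar_mat M X"
    unfolding similar_mat_def
    using similar_mat_witI[OF W'W WW' M_def M X W' W(1)] by blast
  then have "char_poly M = [:- e, 1:] * (\<Prod>e\<leftarrow>es. [:- e, 1:])"
    using char_poly_similar[of M X] Cons.prems(3) by simp
  moreover have "char_poly M = char_poly E * char_poly M3"
    unfolding Mblock by (rule char_poly_four_block_zeros_col[OF E _ M3]) simp
  moreover have "char_poly E = [:- e, 1:]"
    by (simp add: E_def char_poly_defs det_def sign_def)
  ultimately have "char_poly M3 = (\<Prod>e\<leftarrow>es. [:- e, 1:])"
    by (metis mult_cancel_left pCons_eq_0_iff zero_neq_one)
  from Cons.IH[OF M3 M3_herm this] obtain U where U: "U \<in> carrier_mat m m" "unitary_mat U"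
    and M3_eq: "M3 = U * mat_diag m (\<lambda>i. es ! i) * mat_adjoint U"
    by (elim bexE conjE) (rule that)
  \<comment> \<open>The unitary \<open>U\<close> for the lower block, extended by the identity on
    the split-off eigenvector. The diagonalizing unitary of \<open>X\<close> is then
    \<open>W * V\<close>.\<close>
  define V where "V = four_block_mat (1\<^sub>m 1) (0\<^sub>m 1 m) (0\<^sub>m m 1) U"
  have V: "V \<in> carrier_mat n n" unfolding V_def n using U(1) by (intro carrier_matI) auto
  have [simp]: "mat_adjoint (1\<^sub>m k) = (1\<^sub>m k :: complex mat)" for k by (rule eq_matI) auto
  have V_adj: "mat_adjoint V = four_block_mat (1\<^sub>m 1) (0\<^sub>m 1 m) (0\<^sub>m m 1) (mat_adjoint U)"
    using mat_adjoint_four_block_diag[of "1\<^sub>m 1" 1 U m] U(1) by (simp add: V_def)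
  have U': "mat_adjoint U \<in> carrier_mat m m" using U(1) by (rule mat_adjoint_carrier)
  have "mat_adjoint V * V = four_block_mat (1\<^sub>m 1) (0\<^sub>m 1 m) (0\<^sub>m m 1) (mat_adjoint U * U)"
    unfolding V_adj unfolding V_def using U U' by (subst mult_four_block_diag) auto
  then have V_unit: "unitary_mat V"
    using unitary_matD[OF U] by (intro unitary_matI[OF V]) (simp add: n)
  have diag: "mat_diag n (\<lambda>i. (e # es) ! i) =
      four_block_mat E (0\<^sub>m 1 m) (0\<^sub>m m 1) (mat_diag m (\<lambda>i. es ! i))"
    by (rule eq_matI) (auto simp: E_def mat_diag_def n nth_Cons')
  have D: "mat_diag n (\<lambda>i. (e # es) ! i) \<in> carrier_mat n n" by simp
  have "V * mat_diag n (\<lambda>i. (e # es) ! i) * mat_adjoint V = M"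
  proof -
    have "V * mat_diag n (\<lambda>i. (e # es) ! i) =
        four_block_mat E (0\<^sub>m 1 m) (0\<^sub>m m 1) (U * mat_diag m (\<lambda>i. es ! i))"
      unfolding V_def diag using U E by (subst mult_four_block_diag) auto
    then show ?thesis
      unfolding V_adj Mblock M3_eq using U U' E
      by (simp add: mult_four_block_diag mult_carrier_mat[of _ m m _ m])
  qed
  moreover have "X = W * M * W'"
  proof -
    have "W * M * W' = (W * W') * X * (W * W')"
      using X W(1) W' unfolding M_def by (simp add: as cm)
    then show ?thesis using X by (simp add: WW')
  qed
  moreover have "W * V * D * mat_adjoint (W * V) = W * (V * D * mat_adjoint V) * W'"
    if "D \<in> carrier_mat n n" for D
    using V W(1) W' mat_adjoint_carrier[OF V] that
    by (simp add: mat_adjoint_mult[OF W(1) V] as cm flip: W'_def)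
  ultimately have "X = W * V * mat_diag n (\<lambda>i. (e # es) ! i) * mat_adjoint (W * V)"
    using D by metis
  moreover have "W * V \<in> carrier_mat n n" using W(1) V by (rule mult_carrier_mat)
  ultimately show ?case using unitary_mat_mult[OF W V V_unit] by blast
qed

lemma proots_prod_list_linear:
  "proots (\<Prod>e\<leftarrow>es. [:- e, 1:]) = mset (es :: 'a :: idom list)"
proof (induction es)
  case (Cons e es)
  have "(\<Prod>e\<leftarrow>es. [:- e, 1:]) \<noteq> 0" by (auto simp: prod_list_zero_iff)
  with Cons show ?case by (simp add: proots_mult del: mult_pCons_left)
qed simp

text \<open>Bridge from \<open>eigval_desc\<close>, defined by roots of the characteristic
  polynomial, to an eigenbasis: sort the roots by decreasing real part and diagonalize in that
  order.\<close>

lemma hermitian_eigval_desc: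
  assumes X: "X \<in> carrier_mat n n" "hermitian_mat X"
  obtains U where "U \<in> carrier_mat n n" "unitary_mat U"
    "X = unitary_diag n U (\<lambda>i. eigval_desc X (Suc i))"
    "\<And>i j. i \<le> j \<Longrightarrow> j < n \<Longrightarrow> eigval_desc X (Suc j) \<le> eigval_desc X (Suc i)"
proof -
  obtain as where as: "char_poly X = (\<Prod>a\<leftarrow>as. [:- a, 1:])" "length as = n"
    using char_poly_factorized[OF X(1)] by blast
  define es where "es = rev (sort_key Re as)"
  have mset_es: "mset es = mset as" and len: "length es = n" by (simp_all add: es_def as)
  have cp: "char_poly X = (\<Prod>e\<leftarrow>es. [:- e, 1:])"
    unfolding as(1) by (simp add: mset_es flip: prod_mset_prod_list)
  have sorted: "sorted (rev (map Re es))" by (simp add: es_def rev_map)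
  have ev: "eigval_desc X (Suc i) = Re (es ! i)" if "i < n" for i
  proof -
    have "sorted_list_of_multiset (image_mset Re (proots (char_poly X))) = sort (map Re es)"
      by (simp add: cp proots_prod_list_linear flip: mset_map)
    also have "\<dots> = rev (map Re es)"
      using sorted by (intro properties_for_sort) auto
    finally show ?thesis using that len by (simp add: eigval_desc_def)
  qed
  obtain U where U: "U \<in> carrier_mat n n" "unitary_mat U"
    and XU: "X = U * mat_diag n (\<lambda>i. es ! i) * mat_adjoint U"
    using hermitian_diagonalization[OF X cp] by blast
  define D where "D = mat_diag n (\<lambda>i. es ! i)"
  have D: "D \<in> carrier_mat n n" by (simp add: D_def)
  \<comment> \<open>Conjugating back shows that \<open>D\<close> is Hermitian, so its diagonal
    entries are real and taking \<open>Re\<close> does not change them.\<close>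
  have "mat_adjoint U * X * U = (mat_adjoint U * U) * D * (mat_adjoint U * U)"
    using U(1) D mat_adjoint_carrier[OF U(1)] unfolding XU D_def[symmetric]
    by (simp add: assoc_mult_mat[of _ n n _ n _ n] mult_carrier_mat[of _ n n _ n])
  then have "mat_adjoint U * X * U = D" using D by (simp add: unitary_matD[OF U])
  then have "hermitian_mat D" using hermitian_mat_unitary_conj[OF X U(1)] by simp
  then have real: "cnj (es ! i) = es ! i" if "i < n" for i
    using arg_cong[of _ _ "\<lambda>Y. Y $$ (i, i)", OF \<open>hermitian_mat D\<close>[unfolded hermitian_mat_def]] that
    by (simp add: D_def mat_diag_def)
  have "D = mat_diag n (\<lambda>i. complex_of_real (eigval_desc X (Suc i)))"
    using real ev unfolding D_def mat_diag_def by (intro eq_matI) (auto simp: complex_eq_iff)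
  then have "X = unitary_diag n U (\<lambda>i. eigval_desc X (Suc i))"
    using XU by (simp add: unitary_diag_def D_def)
  moreover have "eigval_desc X (Suc j) \<le> eigval_desc X (Suc i)" if "i \<le> j" "j < n" for i j
    using sorted_rev_nth_mono[OF sorted, of i j] that len by (simp add: ev)
  ultimately show ?thesis using U that by blast
qed

section \<open>Quadratic forms and comparison of ordered eigenvalues\<close>

lemma unitary_diag_form:
  assumes U: "U \<in> carrier_mat n n" and v: "v \<in> carrier_vec n"
  shows "Re ((unitary_diag n U a *\<^sub>v v) \<bullet>c v) = (\<Sum>i<n. a i * (cmod ((mat_adjoint U *\<^sub>v v) $ i))\<^sup>2)"
proof -
  define w where "w = mat_adjoint U *\<^sub>v v"
  define D where "D = mat_diag n (\<lambda>i. complex_of_real (a i))"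
  have U': "mat_adjoint U \<in> carrier_mat n n" by (rule mat_adjoint_carrier[OF U])
  have w: "w \<in> carrier_vec n" using U' v by (simp add: w_def)
  have D: "D \<in> carrier_mat n n" by (simp add: D_def)
  have "unitary_diag n U a *\<^sub>v v = U *\<^sub>v (D *\<^sub>v w)"
    using U U' D v by (simp add: unitary_diag_def w_def D_def[symmetric]
        assoc_mult_mat_vec[of _ n n _ n] mult_carrier_mat[of _ n n _ n])
  then have "(unitary_diag n U a *\<^sub>v v) \<bullet>c v = (D *\<^sub>v w) \<bullet>c w"
    using mult_mat_vec_adjoint_left[OF U _ v, of "D *\<^sub>v w"] D w by (simp add: w_def)
  also have "\<dots> = (\<Sum>i<n. (D *\<^sub>v w) $ i * cnj (w $ i))"
    using w by (simp add: scalar_prod_def lessThan_atLeast0)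
  also have "\<dots> = (\<Sum>i<n. complex_of_real (a i * (cmod (w $ i))\<^sup>2))"
  proof (rule sum.cong[OF refl])
    fix i assume "i \<in> {..<n}"
    then have i: "i < n" by simp
    have "(D *\<^sub>v w) $ i = (\<Sum>k<n. (if i = k then complex_of_real (a k) else 0) * w $ k)"
      using D w i by (auto simp: scalar_prod_def lessThan_atLeast0 D_def mat_diag_def intro!: sum.cong)
    also have "\<dots> = (\<Sum>k<n. if i = k then complex_of_real (a k) * w $ k else 0)"
      by (rule sum.cong) auto
    also have "\<dots> = complex_of_real (a i) * w $ i" using i by simp
    finally show "(D *\<^sub>v w) $ i * cnj (w $ i) = complex_of_real (a i * (cmod (w $ i))\<^sup>2)"
      using complex_norm_square[of "w $ i"] by (simp add: mult.assoc)
  qed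
  finally show ?thesis by (simp add: w_def)
qed

lemma unitary_diag_one:
  assumes "U \<in> carrier_mat n n" "unitary_mat U"
  shows "unitary_diag n U (\<lambda>_. 1) = 1\<^sub>m n"
  using unitary_matD[OF assms] assms(1) by (simp add: unitary_diag_def)

lemma unitary_cscalar_prod:
  assumes U: "U \<in> carrier_mat n n" "unitary_mat U" and v: "v \<in> carrier_vec n"
  shows "Re (v \<bullet>c v) = (\<Sum>i<n. (cmod ((mat_adjoint U *\<^sub>v v) $ i))\<^sup>2)"
  using unitary_diag_form[OF U(1) v, of "\<lambda>_. 1"] v by (simp add: unitary_diag_one[OF U])

text \<open>Dimension count: \<open>d - 1 - j\<close> coordinate conditions and \<open>j\<close>
  conditions from rows of \<open>Z\<close> are \<open>d - 1\<close> homogeneous linear equations in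
  \<open>d\<close> unknowns.\<close>

lemma exists_vec_vanishing:
  fixes Z :: "'a :: idom mat"
  assumes Z: "Z \<in> carrier_mat d d" and j: "j < d"
  obtains x :: "'a vec" where "x \<in> carrier_vec d" "x \<noteq> 0\<^sub>v d" "\<And>i. j < i \<Longrightarrow> i < d \<Longrightarrow> x $ i = 0"
    "\<And>i. i < j \<Longrightarrow> (Z *\<^sub>v x) $ i = 0"
proof -
  \<comment> \<open>The required equations, completed by a zero row to a singular square system.\<close>
  define r where "r i = (if i < j then row Z i else unit_vec d i)" for i
  define M where "M = mat\<^sub>r d d (\<lambda>i. if i = j then 0\<^sub>v d else r i)"
  have r: "r i \<in> carrier_vec d" if "i < d" for i using that Z by (simp add: r_def)
  have M: "M \<in> carrier_mat d d" by (simp add: M_def carrier_matI)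
  have "det M = 0" unfolding M_def by (rule det_row_0[OF j]) (use r in auto)
  then obtain x where x: "x \<in> carrier_vec d" "x \<noteq> 0\<^sub>v d" and Mx: "M *\<^sub>v x = 0\<^sub>v d"
    using det_0_iff_vec_prod_zero[OF M] by blast
  have rx: "r i \<bullet> x = 0" if "i < d" "i \<noteq> j" for i
    using arg_cong[OF Mx, of "\<lambda>y. vec_index y i"] that M r[OF that(1)] by (simp add: M_def)
  show ?thesis
  proof (rule that[OF x])
    show "x $ i = 0" if "j < i" "i < d" for i using rx[of i] that x by (simp add: r_def)
    show "(Z *\<^sub>v x) $ i = 0" if "i < j" for i using rx[of i] that Z j by (simp add: r_def)
  qed
qed

text \<open>A single nonzero test vector decides: the form of \<open>H\<close> there is at least its
  eigenvalue times the squared norm, that of \<open>K\<close> at most its own. The affine shape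
  avoids computing eigenvalues of \<alpha> K + \<beta> I, and \<alpha> being nonnegative preserves
  the direction of the bound for \<open>K\<close>.\<close>

lemma eigval_desc_le:
  assumes H: "H \<in> carrier_mat d d" "hermitian_mat H" and K: "K \<in> carrier_mat d d" "hermitian_mat K"
    and \<alpha>: "0 \<le> \<alpha>"
    and le: "\<And>v. v \<in> carrier_vec d \<Longrightarrow>
      Re ((H *\<^sub>v v) \<bullet>c v) \<le> \<alpha> * Re ((K *\<^sub>v v) \<bullet>c v) + \<beta> * Re (v \<bullet>c v)"
    and j: "j < d"
  shows "eigval_desc H (Suc j) \<le> \<alpha> * eigval_desc K (Suc j) + \<beta>"
proof -
  obtain U where U: "U \<in> carrier_mat d d" "unitary_mat U"
    and HU: "H = unitary_diag d U (\<lambda>i. eigval_desc H (Suc i))"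
    and H_mono: "\<And>i j. i \<le> j \<Longrightarrow> j < d \<Longrightarrow> eigval_desc H (Suc j) \<le> eigval_desc H (Suc i)"
    using hermitian_eigval_desc[OF H] by blast
  obtain W where W: "W \<in> carrier_mat d d" "unitary_mat W"
    and KW: "K = unitary_diag d W (\<lambda>i. eigval_desc K (Suc i))"
    and K_mono: "\<And>i j. i \<le> j \<Longrightarrow> j < d \<Longrightarrow> eigval_desc K (Suc j) \<le> eigval_desc K (Suc i)"
    using hermitian_eigval_desc[OF K] by blast
  have U': "mat_adjoint U \<in> carrier_mat d d" and W': "mat_adjoint W \<in> carrier_mat d d"
    using mat_adjoint_carrier U(1) W(1) by blast+
  \<comment> \<open>Courant-Fischer: \<open>U x\<close> is a common vector of the span of the first \<open>j + 1\<close> eigenvectors of \<open>H\<close>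
    and the span of the last \<open>d - j\<close> eigenvectors of \<open>K\<close>.\<close>
  obtain x :: "complex vec" where x: "x \<in> carrier_vec d" "x \<noteq> 0\<^sub>v d"
    and x0: "\<And>i. j < i \<Longrightarrow> i < d \<Longrightarrow> x $ i = 0"
    and y0: "\<And>i. i < j \<Longrightarrow> (mat_adjoint W * U *\<^sub>v x) $ i = 0"
    using exists_vec_vanishing[OF mult_carrier_mat[OF W' U(1)] j] by blast
  define v where "v = U *\<^sub>v x"
  define y where "y = mat_adjoint W *\<^sub>v v"
  define N where "N = (\<Sum>i<d. (cmod (x $ i))\<^sup>2)"
  have v: "v \<in> carrier_vec d" using U x by (simp add: v_def)
  have xv: "mat_adjoint U *\<^sub>v v = x"
    using U' U(1) x unitary_matD[OF U]
    by (simp add: v_def assoc_mult_mat_vec[symmetric, of _ d d _ d] del: assoc_mult_mat_vec)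
  have y0: "y $ i = 0" if "i < j" for i
    using y0[OF that] W' U(1) x by (simp add: y_def v_def assoc_mult_mat_vec[of _ d d _ d])
  have Nv: "Re (v \<bullet>c v) = N" using unitary_cscalar_prod[OF U v] by (simp add: xv N_def)
  have Ny: "(\<Sum>i<d. (cmod (y $ i))\<^sup>2) = N" using unitary_cscalar_prod[OF W v] by (simp add: y_def Nv)
  have "\<exists>i<d. x $ i \<noteq> 0"
  proof (rule ccontr)
    assume "\<not> (\<exists>i<d. x $ i \<noteq> 0)"
    then have "x = 0\<^sub>v d" using x(1) by (intro eq_vecI) auto
    with x(2) show False by simp
  qed
  then obtain i where i: "i < d" "x $ i \<noteq> 0" by blast
  have "0 < (cmod (x $ i))\<^sup>2" using i by simp
  also have "\<dots> \<le> N" unfolding N_def using i by (intro member_le_sum) auto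
  finally have N: "0 < N" .
  \<comment> \<open>Only coordinates of \<open>x\<close> up to index \<open>j\<close> survive, and
    there the eigenvalues of \<open>H\<close> are at least the one at \<open>j\<close>.\<close>
  have "eigval_desc H (Suc j) * N \<le> (\<Sum>i<d. eigval_desc H (Suc i) * (cmod (x $ i))\<^sup>2)"
    unfolding N_def sum_distrib_left
  proof (rule sum_mono)
    fix i assume "i \<in> {..<d}"
    then show "eigval_desc H (Suc j) * (cmod (x $ i))\<^sup>2 \<le> eigval_desc H (Suc i) * (cmod (x $ i))\<^sup>2"
      using H_mono[of i j] x0[of i] j by (cases "i \<le> j") (auto intro!: mult_right_mono)
  qed
  also have "\<dots> = Re ((H *\<^sub>v v) \<bullet>c v)"
    using unitary_diag_form[OF U(1) v, of "\<lambda>i. eigval_desc H (Suc i)"] by (simp add: xv flip: HU)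
  also have "\<dots> \<le> \<alpha> * Re ((K *\<^sub>v v) \<bullet>c v) + \<beta> * N" using le[OF v] by (simp add: Nv)
  finally have HK: "eigval_desc H (Suc j) * N \<le> \<alpha> * Re ((K *\<^sub>v v) \<bullet>c v) + \<beta> * N" .
  have "Re ((K *\<^sub>v v) \<bullet>c v) = (\<Sum>i<d. eigval_desc K (Suc i) * (cmod (y $ i))\<^sup>2)"
    using unitary_diag_form[OF W(1) v, of "\<lambda>i. eigval_desc K (Suc i)"] by (simp add: y_def flip: KW)
  \<comment> \<open>Dually, only coordinates of \<open>y\<close> from index \<open>j\<close> on
    survive, where the eigenvalues of \<open>K\<close> are at most the one at
    \<open>j\<close>.\<close>
  also have "\<dots> \<le> eigval_desc K (Suc j) * N"
    unfolding Ny[symmetric] sum_distrib_left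
  proof (rule sum_mono)
    fix i assume "i \<in> {..<d}"
    then show "eigval_desc K (Suc i) * (cmod (y $ i))\<^sup>2 \<le> eigval_desc K (Suc j) * (cmod (y $ i))\<^sup>2"
      using K_mono[of j i] y0[of i] by (cases "i < j") (auto intro!: mult_right_mono)
  qed
  finally have "\<alpha> * Re ((K *\<^sub>v v) \<bullet>c v) \<le> \<alpha> * (eigval_desc K (Suc j) * N)"
    using \<alpha> by (rule mult_left_mono)
  with HK have "eigval_desc H (Suc j) * N \<le> (\<alpha> * eigval_desc K (Suc j) + \<beta>) * N"
    by (simp add: algebra_simps)
  then show ?thesis using N by simp
qed

section \<open>Linearity and positivity of the functional calculus in a fixed eigenbasis\<close>

lemma unitary_diag_index:
  assumes "U \<in> carrier_mat n n" "i < n" "j < n"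
  shows "unitary_diag n U a $$ (i, j) = (\<Sum>k<n. U $$ (i,k) * complex_of_real (a k) * cnj (U $$ (j,k)))"
  using assms mat_adjoint_carrier[OF assms(1)] unfolding unitary_diag_def
  by (auto simp: mat_diag_mult_right[OF assms(1)] scalar_prod_def lessThan_atLeast0 intro!: sum.cong)

lemma unitary_diag_add:
  assumes U: "U \<in> carrier_mat n n"
  shows "unitary_diag n U (\<lambda>i. a i + b i) = unitary_diag n U a + unitary_diag n U b"
  using unitary_diag_carrier[OF U, of a] unitary_diag_carrier[OF U, of b]
    unitary_diag_carrier[OF U, of "\<lambda>i. a i + b i"]
  by (intro eq_matI) (auto simp: unitary_diag_index[OF U] algebra_simps sum.distrib)

lemma unitary_diag_smult:
  assumes U: "U \<in> carrier_mat n n"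
  shows "unitary_diag n U (\<lambda>i. c * a i) = complex_of_real c \<cdot>\<^sub>m unitary_diag n U a"
  using unitary_diag_carrier[OF U, of a] unitary_diag_carrier[OF U, of "\<lambda>i. c * a i"]
  by (intro eq_matI) (auto simp: unitary_diag_index[OF U] sum_distrib_left mult_ac)

lemma hermitian_unitary_diag:
  assumes U: "U \<in> carrier_mat n n"
  shows "hermitian_mat (unitary_diag n U a)"
  unfolding hermitian_mat_def using unitary_diag_carrier[OF U, of a]
  by (intro eq_matI) (auto simp: unitary_diag_index[OF U] mult_ac)

text \<open>Left to right gives nonnegative eigenvalues of psd matrices; right to left makes
  nonnegative functions of a matrix admissible for a positive map.\<close>

lemma psd_unitary_diag_iff:
  assumes U: "U \<in> carrier_mat n n" "unitary_mat U"
  shows "psd_mat (unitary_diag n U a) \<longleftrightarrow> (\<forall>i<n. 0 \<le> a i)"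
proof -
  have dim: "dim_row (unitary_diag n U a) = n" using unitary_diag_carrier[OF U(1), of a] by simp
  have "psd_mat (unitary_diag n U a)" if "\<forall>i<n. 0 \<le> a i"
    using hermitian_unitary_diag[OF U(1)] that
    by (auto simp: psd_mat_def dim unitary_diag_form[OF U(1)] intro!: sum_nonneg)
  moreover have "\<forall>i<n. 0 \<le> a i" if psd: "psd_mat (unitary_diag n U a)"
  proof (intro allI impI)
    fix i assume i: "i < n"
    \<comment> \<open>The \<open>i\<close>-th column of \<open>U\<close>, an eigenvector on which
      the form takes the value \<open>a i\<close>.\<close>
    define v where "v = U *\<^sub>v unit_vec n i"
    have v: "v \<in> carrier_vec n" using U(1) by (simp add: v_def)
    have "mat_adjoint U *\<^sub>v v = unit_vec n i"
      using mat_adjoint_carrier[OF U(1)] U(1) unitary_matD[OF U]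
      by (simp add: v_def assoc_mult_mat_vec[symmetric, of _ n n _ n] del: assoc_mult_mat_vec)
    then have "Re ((unitary_diag n U a *\<^sub>v v) \<bullet>c v) = (\<Sum>k<n. if k = i then a k else 0)"
      unfolding unitary_diag_form[OF U(1) v] using i by (intro sum.cong) auto
    also have "\<dots> = a i" using i by simp
    finally show "0 \<le> a i" using psd v dim by (auto simp: psd_mat_def)
  qed
  ultimately show ?thesis by blast
qed

lemma eigval_desc_nonneg:
  assumes X: "X \<in> carrier_mat n n" "psd_mat X" and j: "j < n"
  shows "0 \<le> eigval_desc X (Suc j)"
proof -
  have "hermitian_mat X" using X(2) by (simp add: psd_mat_def)
  then obtain U where U: "U \<in> carrier_mat n n" "unitary_mat U"
    and XU: "X = unitary_diag n U (\<lambda>i. eigval_desc X (Suc i))"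
    by (rule hermitian_eigval_desc[OF X(1)]) (rule that)
  show ?thesis using psd_unitary_diag_iff[OF U, of "\<lambda>i. eigval_desc X (Suc i)"] X(2) j
    by (simp flip: XU)
qed

section \<open>Transport of affine scalar inequalities through a unital positive map\<close>

lemma add_form:
  fixes X Y :: "complex mat"
  assumes "X \<in> carrier_mat n n" "Y \<in> carrier_mat n n" "v \<in> carrier_vec n"
  shows "((X + Y) *\<^sub>v v) \<bullet>c v = (X *\<^sub>v v) \<bullet>c v + (Y *\<^sub>v v) \<bullet>c v"
  using assms by (simp add: add_mult_distrib_mat_vec[of _ n n] add_scalar_prod_distrib[of _ n])

lemma smult_form:
  fixes X :: "complex mat"
  assumes "X \<in> carrier_mat n n" "v \<in> carrier_vec n"
  shows "((c \<cdot>\<^sub>m X) *\<^sub>v v) \<bullet>c v = c * ((X *\<^sub>v v) \<bullet>c v)"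
proof -
  have "(c \<cdot>\<^sub>m X) *\<^sub>v v = c \<cdot>\<^sub>v (X *\<^sub>v v)"
    using assms by (intro eq_vecI) auto
  then show ?thesis using assms by simp
qed

text \<open>For fixed \<open>U\<close>, the map from diagonal entries to \<Phi> of the matrix is
  linear, positive and sends the constant 1 to the identity, so the entrywise bound becomes a
  Loewner bound. Nonnegativity of \<open>g\<close> and \<open>h\<close> makes both images psd, in
  particular Hermitian, as \<open>eigval_desc_le\<close> requires.\<close>

lemma positive_map_eigval_desc_le:
  assumes \<Phi>: "linear_mat_map n d \<Phi>" "positive_mat_map n \<Phi>" "unital_mat_map n d \<Phi>"
    and U: "U \<in> carrier_mat n n" "unitary_mat U"
    and g: "\<And>i. i < n \<Longrightarrow> 0 \<le> g i" and h: "\<And>i. i < n \<Longrightarrow> 0 \<le> h i"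
    and \<alpha>: "0 \<le> \<alpha>" and le: "\<And>i. i < n \<Longrightarrow> g i \<le> \<alpha> * h i + \<beta>"
    and j: "j < d"
  shows "eigval_desc (\<Phi> (unitary_diag n U g)) (Suc j)
    \<le> \<alpha> * eigval_desc (\<Phi> (unitary_diag n U h)) (Suc j) + \<beta>"
proof -
  define T where "T a = unitary_diag n U a" for a
  have T: "T a \<in> carrier_mat n n" for a by (simp add: T_def unitary_diag_carrier[OF U(1)])
  have \<Phi>T: "\<Phi> (T a) \<in> carrier_mat d d" for a using \<Phi>(1) T by (simp add: linear_mat_map_def)
  have psd: "psd_mat (\<Phi> (T a))" if "\<And>i. i < n \<Longrightarrow> 0 \<le> a i" for a
    using \<Phi>(2) T psd_unitary_diag_iff[OF U, of a] that by (simp add: positive_mat_map_def T_def)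
  have \<Phi>T_add: "\<Phi> (T (\<lambda>i. a i + b i)) = \<Phi> (T a) + \<Phi> (T b)" for a b
    using \<Phi>(1) T by (simp add: linear_mat_map_def unitary_diag_add[OF U(1)] T_def)
  have \<Phi>T_smult: "\<Phi> (T (\<lambda>i. c * a i)) = complex_of_real c \<cdot>\<^sub>m \<Phi> (T a)" for c a
    using \<Phi>(1) T by (simp add: linear_mat_map_def unitary_diag_smult[OF U(1)] T_def)
  have \<Phi>T_one: "\<Phi> (T (\<lambda>_. 1)) = 1\<^sub>m d"
    using \<Phi>(3) by (simp add: unital_mat_map_def T_def unitary_diag_one[OF U])
  \<comment> \<open>The slack of the scalar inequality, whose image is psd. Writing the constant as
    \<beta> \<open>* 1\<close> displays it as a multiple of the constant function 1, whose image is
    known.\<close>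
  define c where "c i = \<alpha> * h i + \<beta> * 1 - g i" for i
  have form: "Re ((\<Phi> (T g) *\<^sub>v v) \<bullet>c v) \<le> \<alpha> * Re ((\<Phi> (T h) *\<^sub>v v) \<bullet>c v) + \<beta> * Re (v \<bullet>c v)"
    if v: "v \<in> carrier_vec d" for v
  proof -
    have "\<Phi> (T g) + \<Phi> (T c) = \<Phi> (T (\<lambda>i. \<alpha> * h i + \<beta> * 1))"
      by (simp add: c_def flip: \<Phi>T_add)
    also have "\<dots> = complex_of_real \<alpha> \<cdot>\<^sub>m \<Phi> (T h) + complex_of_real \<beta> \<cdot>\<^sub>m 1\<^sub>m d"
      by (simp only: \<Phi>T_add \<Phi>T_smult \<Phi>T_one)
    finally have "((\<Phi> (T g) + \<Phi> (T c)) *\<^sub>v v) \<bullet>c v =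
        ((complex_of_real \<alpha> \<cdot>\<^sub>m \<Phi> (T h) + complex_of_real \<beta> \<cdot>\<^sub>m 1\<^sub>m d) *\<^sub>v v) \<bullet>c v" by simp
    then have "(\<Phi> (T g) *\<^sub>v v) \<bullet>c v + (\<Phi> (T c) *\<^sub>v v) \<bullet>c v =
        complex_of_real \<alpha> * ((\<Phi> (T h) *\<^sub>v v) \<bullet>c v) + complex_of_real \<beta> * (v \<bullet>c v)"
      using \<Phi>T v by (simp add: add_form[of _ d] smult_form[of _ d])
    then have "Re ((\<Phi> (T g) *\<^sub>v v) \<bullet>c v) + Re ((\<Phi> (T c) *\<^sub>v v) \<bullet>c v) =
        \<alpha> * Re ((\<Phi> (T h) *\<^sub>v v) \<bullet>c v) + \<beta> * Re (v \<bullet>c v)"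
      by (simp add: complex_eq_iff)
    moreover have "0 \<le> Re ((\<Phi> (T c) *\<^sub>v v) \<bullet>c v)"
      using psd[of c] le v \<Phi>T[of c] by (auto simp: psd_mat_def c_def)
    ultimately show ?thesis by simp
  qed
  show ?thesis
    using eigval_desc_le[OF \<Phi>T _ \<Phi>T _ \<alpha> form j] psd[OF g] psd[OF h]
    by (simp add: psd_mat_def T_def)
qed

section \<open>The scalar inequality\<close>

text \<open>Weighted AM-GM for \<open>y\<close> and 1. With \<open>m\<close> their weighted mean,
  add the bounds ln z <= z - 1 at z = y/m and z = 1/m with weights \<open>t\<close> and
  \<open>1 - t\<close>: the right-hand sides sum to 0.\<close>

lemma powr_le_affine:
  fixes y t :: real
  assumes "0 < y" "0 \<le> t" "t \<le> 1"
  shows "y powr t \<le> t * y + (1 - t)"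
proof -
  define m where "m = t * y + (1 - t)"
  have m: "0 < m"
    using assms by (cases "t = 1") (auto simp: m_def intro!: add_nonneg_pos)
  have "t * ln (y / m) + (1 - t) * ln (1 / m) \<le> t * (y / m - 1) + (1 - t) * (1 / m - 1)"
    using assms m by (intro add_mono mult_left_mono ln_le_minus_one) auto
  also have "\<dots> = (t * y + (1 - t)) / m - 1" 
    by (simp add: field_simps add_divide_distrib diff_divide_distrib)
  also have "\<dots> = 0" using m by (simp add: m_def)
  finally have "t * ln y \<le> ln m" using assms m by (simp add: ln_div algebra_simps)
  then have "exp (t * ln y) \<le> m" using m by (metis exp_le_cancel_iff exp_ln)
  then show ?thesis using assms by (simp add: powr_def m_def)
qed

text \<open>The scalar function to which \<open>mat_powr\<close> applies the functional
  calculus.\<close>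

definition powr0 :: "real \<Rightarrow> real \<Rightarrow> real" where
  "powr0 p x = (if p = 0 then 1 else x powr p)"

lemma powr0_nonneg: "0 \<le> powr0 p x"
  by (simp add: powr0_def)

text \<open>The parameter \<open>e\<close> only sets the scale: for x = e z with z > 0 the claim is
  \<open>powr_le_affine\<close> at y = z^(p+q) and t = p/(p+q), multiplied by e^p.\<close>

lemma powr0_le_affine:
  fixes p q x e :: real
  assumes pq: "0 \<le> p" "0 \<le> q" "0 < p + q" and x: "0 \<le> x" and e: "0 < e"
  shows "powr0 p x \<le> p / (p + q) * e powr (- q) * powr0 (p + q) x + q / (p + q) * e powr p"
proof (cases "x = 0")
  case True
  \<comment> \<open>At x = 0 both sides are 1 if p = 0; otherwise the left side is 0 and the right
    side nonnegative.\<close>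
  then show ?thesis using pq e by (cases "p = 0") (auto simp: powr0_def)
next
  case False
  define t where "t = p / (p + q)"
  define z where "z = x / e"
  have z: "0 < z" using False x e by (simp add: z_def)
  have t: "0 \<le> t" "t \<le> 1" "1 - t = q / (p + q)" "(p + q) * t = p"
    using pq by (auto simp: t_def field_simps)
  have xz: "x = e * z" using e by (simp add: z_def)
  have "z powr p \<le> t * z powr (p + q) + (1 - t)"
    using powr_le_affine[of "z powr (p + q)" t] z t by (simp add: powr_powr)
  then have "e powr p * z powr p \<le> e powr p * (t * z powr (p + q) + (1 - t))"
    by (intro mult_left_mono) auto
  moreover have "e powr p = e powr (- q) * e powr (p + q)" by (simp flip: powr_add)
  ultimately have "(e * z) powr p \<le> t * e powr (- q) * (e * z) powr (p + q) + (1 - t) * e powr p"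
    using e z by (simp add: powr_mult algebra_simps)
  moreover have "powr0 p x = x powr p" using False by (simp add: powr0_def)
  ultimately show ?thesis using pq by (simp add: powr0_def xz t flip: t_def)
qed

section \<open>The product inequality for eigenvalues\<close>

theorem proposition2p6:
  fixes n d :: nat and A :: "complex mat" and p q :: real
    and \<Phi> :: "complex mat \<Rightarrow> complex mat"
  assumes "A \<in> carrier_mat n n" and "psd_mat A"
    and "p \<ge> 0" and "q \<ge> 0"
    and "linear_mat_map n d \<Phi>" and "positive_mat_map n \<Phi>" and "unital_mat_map n d \<Phi>"
  shows "\<forall>j \<in> {1..d}. eigval_desc (\<Phi> (mat_powr A p)) j * eigval_desc (\<Phi> (mat_powr A q)) j
           \<le> eigval_desc (\<Phi> (mat_powr A (p + q))) j"
proof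
  fix j assume "j \<in> {1..d}"
  then obtain k where k: "j = Suc k" "k < d" by (cases j) auto
  have "hermitian_mat A" using assms(2) by (simp add: psd_mat_def)
  then obtain U where U: "U \<in> carrier_mat n n" "unitary_mat U"
    and AU: "A = unitary_diag n U (\<lambda>i. eigval_desc A (Suc i))"
    by (rule hermitian_eigval_desc[OF assms(1)]) (rule that)
  define a where "a = (\<lambda>i. eigval_desc A (Suc i))"
  have a: "0 \<le> a i" if "i < n" for i
    using eigval_desc_nonneg[OF assms(1,2) that] by (simp add: a_def)
  have AU: "A = unitary_diag n U a" using AU unfolding a_def .
  \<comment> \<open>One eigenbasis serves all exponents, so powers of \<open>A\<close> can be
    compared through the scalars \<open>a i\<close>.\<close>
  have powr: "mat_powr A s = unitary_diag n U (\<lambda>i. powr0 s (a i))" for s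
    unfolding mat_powr_def mat_fun_eq[OF U AU] by (simp add: comp_def powr0_def)
  define l where "l s = eigval_desc (\<Phi> (mat_powr A s)) (Suc k)" for s
  note le = positive_map_eigval_desc_le[OF assms(5-7) U _ _ _ _ k(2)]
  have l_nonneg: "0 \<le> l s" for s
  proof -
    have "mat_powr A s \<in> carrier_mat n n" "psd_mat (mat_powr A s)"
      unfolding powr using unitary_diag_carrier[OF U(1)] psd_unitary_diag_iff[OF U]
      by (simp_all add: powr0_nonneg)
    then show ?thesis
      using assms(5,6) eigval_desc_nonneg[of "\<Phi> (mat_powr A s)" d k] k
      by (simp add: l_def linear_mat_map_def positive_mat_map_def)
  qed
  have "l p * l q \<le> l (p + q)"
  proof (cases "p + q = 0")
    case True
    then have "p = 0" "q = 0" using assms(3,4) by auto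
    \<comment> \<open>With both exponents 0 the claim is l 0 * l 0 <= l 0, which follows from 0 <= l
      0 <= 1; the upper bound compares the constant 1 with itself.\<close>
    have "l 0 \<le> 0 * l 0 + 1"
      unfolding l_def powr by (rule le) (simp_all add: powr0_def)
    then show ?thesis using l_nonneg[of 0] \<open>p = 0\<close> \<open>q = 0\<close> by (simp add: mult_left_le)
  next
    case False
    then have r: "0 < p + q" using assms(3,4) by simp
    \<comment> \<open>Stated for any \<open>s\<close> and \<open>t\<close> with sum
      \<open>p + q\<close>, so that it applies to (p, q) and to (q, p).\<close>
    have bound: "l s \<le> e powr s"
      if st: "0 \<le> s" "0 \<le> t" "s + t = p + q" and e: "0 < e" "l (p + q) \<le> e powr (p + q)" for s t e
    proof -
      have "l s \<le> (s / (p + q) * e powr (- t)) * l (p + q) + t / (p + q) * e powr s"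
        unfolding l_def powr
      proof (rule le)
        show "powr0 s (a i) \<le> s / (p + q) * e powr (- t) * powr0 (p + q) (a i) + t / (p + q) * e powr s"
          if "i < n" for i
          using powr0_le_affine[OF st(1,2) _ a[OF that] e(1)] r by (simp add: st(3))
      qed (use st r in \<open>auto simp: powr0_nonneg\<close>)
      also have "\<dots> \<le> (s / (p + q) * e powr (- t)) * e powr (p + q) + t / (p + q) * e powr s"
        using st r e by (intro add_right_mono mult_left_mono) auto
      \<comment> \<open>Here e^(-t) e^(p+q) = e^s, so both terms are multiples of e^s with weights
        that sum to 1.\<close>
      also have "\<dots> = s / (p + q) * e powr s + t / (p + q) * e powr s"
        by (simp add: st(3)[symmetric] flip: powr_add)
      also have "\<dots> = e powr s"
        using r by (simp add: st(3) flip: distrib_right add_divide_distrib)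
      finally show ?thesis .
    qed
    show ?thesis
    \<comment> \<open>The best \<open>e\<close> would satisfy e^(p+q) = l (p+q), but
      \<open>e\<close> must be positive and this eigenvalue may be 0. Hence an arbitrary
      \<open>y\<close> above it takes its place.\<close>
    proof (rule dense_ge)
      fix y assume y: "l (p + q) < y"
      then have y0: "0 < y" using l_nonneg[of "p + q"] by simp
      define e where "e = y powr (1 / (p + q))"
      have e: "0 < e" "e powr (p + q) = y" using y0 r by (simp_all add: e_def powr_powr)
      have "l p * l q \<le> e powr p * e powr q"
        using bound[of p q e] bound[of q p e] assms(3,4) e y l_nonneg
        by (intro mult_mono) (auto simp: add.commute)
      then show "l p * l q \<le> y" using e by (simp flip: powr_add)
    qed
  qed
  then show "eigval_desc (\<Phi> (mat_powr A p)) j * eigval_desc (\<Phi> (mat_powr A q)) j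
      \<le> eigval_desc (\<Phi> (mat_powr A (p + q))) j"
    by (simp add: l_def k)
qed

end
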